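(* If $(G,\ell_G)\in\mathcal{G}_{or(n)}$ is a connected graph, then there is an OEB (orientable embedded bouquet) in its orbit $Orb(G,\ell_G)$.
   Context: **Ribbon graphs.** A (finite) ribbon graph $G=(V(G),E(G))$ is a surface with boundary presented as the union of a set $V(G)$ of discs (vertices) and a set $E(G)$ of discs (edges) such that vertices and edges intersect in disjoint line segments, each such segment lies on the boundary of precisely one vertex and precisely one edge, and every edge contains exactly two such segments. Two ribbon graphs are isomorphic if there is a homeomorphism (not required to preserve any orientation) taking vertices to vertices and edges to edges; equivalently, if the corresponding cellularly embedded graphs are isomorphic. An OEB (orientable embedded bouquet) is a ribbon graph with exactly one vertex that is orientable as a surface. **Arrow presentations.** A ribbon graph is encoded by drawing each vertex boundary as a circle and recording, for each edge $e$, two directed arcs (arrows) labelled $e$ on the circles, namely the two segments where $e$ meets vertices, directed by an arbitrary orientation of the boundary of the disc $e$. **Operations on one edge.** Let $A,B$ be the two arrows labelled $e$. The partial Petrial (twist) $\tau$ at $e$ reverses the direction of exactly one of $A,B$. The partial dual $\delta$ at $e$: draw a segment with an arrow on it labelled $e$ directed from the head of $A$ to the tail of $B$, and another with an arrow labelled $e$ directed from the head of $B$ to the tail of $A$; then delete $A$, $B$ and the arcs containing them. Vertices may change; the set of edges (labels) is unchanged. It is known that the group $\mathfrak{S} = \langle \delta,\tau \mid \delta^2,\tau^2,(\tau\delta)^3\rangle \cong S_3$ thereby acts on the left on any fixed edge (in a product the rightmost factor is applied first), and operations on distinct edges commute. **Ordered graphs.** $[n]=\{1,\dots,n\}$. $\mathcal{G}_{or(n)}$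 is the set of isomorphism classes of pairs $(G,\ell)$, where $G$ is a ribbon graph with exactly $n$ edges ($n\ge 1$) and $\ell\colon[n]\to E(G)$ is a bijection (a linear ordering of the edges). $(G,\ell_G)$ and $(H,\ell_H)$ are isomorphic if there is a ribbon graph isomorphism $G\to H$ whose edge bijection $g$ satisfies $g\circ\ell_G=\ell_H$. Properties such as connected or OEB refer to the underlying ribbon graph. **Group action.** An element $\hat\gamma\in\mathfrak{S}^n$ is regarded as a map $[n]\to\mathfrak{S}$; multiplication in $\mathfrak{S}^n$ is entrywise, and $\hat\gamma\pi$, for $\pi\in S_n$, is composition of maps. $G^{\Gamma(\hat\gamma,\ell)}$ denotes the ribbon graph obtained from $G$ by applying to each edge $e$ the operation $\hat\gamma(\ell^{-1}(e))$. The group $\mathfrak{S}^n\rtimes S_n$, with multiplication $(\hat\gamma_1,\pi_1)(\hat\gamma_2,\pi_2)=(\hat\gamma_1\cdot\hat\gamma_2\pi_1^{-1},\pi_1\pi_2)$, acts on $\mathcal{G}_{or(n)}$ by $(\hat\gamma,\pi)(G,\ell)=(G^{\Gamma(\hat\gamma,\ell\pi^{-1})},\ell\pi^{-1})$. $Orb(G,\ell_G)$ is the orbit of $(G,\ell_G)$ under this group. *)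

theory Defs
  imports "HOL-Combinatorics.Permutations" "HOL-Library.FuncSet" "HOL-Algebra.Group_Action"
begin

section \<open>Ribbon graphs as arrow presentations\<close>

text \<open>An arrow is the pair of its tail and its head; these are points of a vertex circle. An edge
  carries two arrows.\<close>

type_synonym 'p arrow = "'p \<times> 'p"
type_synonym 'p arrow_pair = "'p arrow \<times> 'p arrow"

fun arrow_ends :: "'p arrow_pair \<Rightarrow> 'p set" where
  "arrow_ends ((a, b), (c, d)) = {a, b, c, d}"

fun arrow_set :: "'p arrow_pair \<Rightarrow> 'p arrow set" where
  "arrow_set (x, y) = {x, y}"

text \<open>Neither the naming of the two arrows as first and second nor the chosen orientation of the
  boundary of the edge disc (hence the common direction of both arrows) is part of the ribbon
  graph.\<close>

fun same_arrows :: "'p arrow_pair \<Rightarrow> 'p arrow_pair \<Rightarrow> bool" where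
  "same_arrows ((a, b), (c, d)) r \<longleftrightarrow>
     r \<in> {((a, b), (c, d)), ((c, d), (a, b)), ((b, a), (d, c)), ((d, c), (b, a))}"

abbreviation map_arrows :: "('p \<Rightarrow> 'q) \<Rightarrow> 'p arrow_pair \<Rightarrow> 'q arrow_pair" where
  "map_arrows f \<equiv> map_prod (map_prod f f) (map_prod f f)"

text \<open>The circles are given implicitly: on a circle that carries an arrow, the arrow segments
  alternate with the arcs between consecutive arrows, and \<open>arc\<close> exchanges the two ends of each such
  arc. Circles without arrows (isolated vertices) are only counted.\<close>

record ('e, 'p) ribbon_graph =
  edges :: "'e set"
  arrows :: "'e \<Rightarrow> 'p arrow_pair"
  arc :: "'p \<Rightarrow> 'p"
  empty_circles :: nat

definition points :: "('e, 'p) ribbon_graph \<Rightarrow> 'p set" where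
  "points G = (\<Union>e\<in>edges G. arrow_ends (arrows G e))"

definition ribbon_graph :: "('e, 'p) ribbon_graph \<Rightarrow> bool" where
  "ribbon_graph G \<longleftrightarrow>
     finite (edges G) \<and>
     (\<forall>e\<in>edges G. card (arrow_ends (arrows G e)) = 4) \<and>
     (\<forall>e\<in>edges G. \<forall>e'\<in>edges G. e \<noteq> e' \<longrightarrow>
        arrow_ends (arrows G e) \<inter> arrow_ends (arrows G e') = {}) \<and>
     (\<forall>p\<in>points G. arc G p \<in> points G \<and> arc G p \<noteq> p \<and> arc G (arc G p) = p)"

text \<open>One step along a vertex circle: across an arc, or along an arrow in either direction.\<close>

definition circle_step :: "('e, 'p) ribbon_graph \<Rightarrow> 'p rel" where
  "circle_step G = (let A = (\<Union>e\<in>edges G. arrow_set (arrows G e))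
                    in {(p, arc G p) | p. p \<in> points G} \<union> A \<union> A\<inverse>)"

definition vertex_at :: "('e, 'p) ribbon_graph \<Rightarrow> 'p \<Rightarrow> 'p set + nat" where
  "vertex_at G p = Inl ((circle_step G)\<^sup>* `` {p})"

definition vertices :: "('e, 'p) ribbon_graph \<Rightarrow> ('p set + nat) set" where
  "vertices G = vertex_at G ` points G \<union> Inr ` {..<empty_circles G}"

definition adjacent :: "('e, 'p) ribbon_graph \<Rightarrow> ('p set + nat) rel" where
  "adjacent G = {(vertex_at G p, vertex_at G q) | p q e.
     e \<in> edges G \<and> p \<in> arrow_ends (arrows G e) \<and> q \<in> arrow_ends (arrows G e)}"

definition connected_ribbon_graph :: "('e, 'p) ribbon_graph \<Rightarrow> bool" where
  "connected_ribbon_graph G \<longleftrightarrow>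
     vertices G \<noteq> {} \<and> (\<forall>u\<in>vertices G. \<forall>v\<in>vertices G. (u, v) \<in> (adjacent G)\<^sup>*)"

text \<open>Orientability of the surface: \<open>\<sigma>\<close> orients every vertex disc and \<open>\<epsilon>\<close> every edge disc.
  \<open>\<sigma> p\<close> means that, traversing the circle in its chosen direction, one enters an arrow segment
  at \<open>p\<close>, so the circle runs along an arrow \<open>(t, h)\<close> in the direction of the arrow iff \<open>\<sigma> t\<close>.
  \<open>\<epsilon> e\<close> means that the boundary of the edge disc runs in the direction of its arrows.
  The orientations of two discs glued along a boundary segment agree iff the boundary orientations
  they induce on that segment are opposite.\<close>

definition orientable :: "('e, 'p) ribbon_graph \<Rightarrow> bool" where
  "orientable G \<longleftrightarrow> (\<exists>(\<sigma> :: 'p \<Rightarrow> bool) (\<epsilon> :: 'e \<Rightarrow> bool).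
     (\<forall>p\<in>points G. \<sigma> (arc G p) \<noteq> \<sigma> p) \<and>
     (\<forall>e\<in>edges G. \<forall>(t, h)\<in>arrow_set (arrows G e). \<sigma> t \<noteq> \<sigma> h \<and> \<sigma> t \<noteq> \<epsilon> e))"

definition OEB :: "('e, 'p) ribbon_graph \<Rightarrow> bool" where
  "OEB G \<longleftrightarrow> ribbon_graph G \<and> card (vertices G) = 1 \<and> orientable G"

text \<open>A homeomorphism of ribbon graphs, recorded by its effect \<open>g\<close> on edges and \<open>f\<close> on arrow ends.
  It may reverse the direction of any circle and of the boundary of any edge disc.\<close>

definition ribbon_iso ::
  "('e \<Rightarrow> 'e) \<Rightarrow> ('p \<Rightarrow> 'p) \<Rightarrow> ('e, 'p) ribbon_graph \<Rightarrow> ('e, 'p) ribbon_graph \<Rightarrow> bool" where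
  "ribbon_iso g f G H \<longleftrightarrow>
     bij_betw g (edges G) (edges H) \<and> bij_betw f (points G) (points H) \<and>
     (\<forall>e\<in>edges G. same_arrows (map_arrows f (arrows G e)) (arrows H (g e))) \<and>
     (\<forall>p\<in>points G. f (arc G p) = arc H (f p)) \<and>
     empty_circles G = empty_circles H"


section \<open>Ordered ribbon graphs\<close>

type_synonym ('e, 'p) ordered_graph = "('e, 'p) ribbon_graph \<times> (nat \<Rightarrow> 'e)"

definition ordered_pairs :: "nat \<Rightarrow> ('e, 'p) ordered_graph set" where
  "ordered_pairs n = {(G, l). ribbon_graph G \<and> card (edges G) = n \<and> bij_betw l {1..n} (edges G)}"

definition ordered_iso :: "nat \<Rightarrow> ('e, 'p) ordered_graph rel" where
  "ordered_iso n = {((G, l), (H, m)). (G, l) \<in> ordered_pairs n \<and> (H, m) \<in> ordered_pairs n \<and>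
     (\<exists>g f. ribbon_iso g f G H \<and> (\<forall>i\<in>{1..n}. g (l i) = m i))}"

definition G_or :: "nat \<Rightarrow> ('e, 'p) ordered_graph set set" where
  "G_or n = ordered_pairs n // ordered_iso n"

definition iso_class :: "nat \<Rightarrow> ('e, 'p) ordered_graph \<Rightarrow> ('e, 'p) ordered_graph set" where
  "iso_class n x = ordered_iso n `` {x}"


section \<open>The group of operations on an edge\<close>

datatype ribbon_gen = Delta | Tau

text \<open>Both generators are involutions, so the presented group is already the monoid with this
  presentation.\<close>

inductive ribbon_eq :: "ribbon_gen list \<Rightarrow> ribbon_gen list \<Rightarrow> bool" where
  refl: "ribbon_eq u u"
| sym: "ribbon_eq u v \<Longrightarrow> ribbon_eq v u"
| trans: "ribbon_eq u v \<Longrightarrow> ribbon_eq v w \<Longrightarrow> ribbon_eq u w"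
| app: "ribbon_eq u v \<Longrightarrow> ribbon_eq u' v' \<Longrightarrow> ribbon_eq (u @ u') (v @ v')"
| delta2: "ribbon_eq [Delta, Delta] []"
| tau2: "ribbon_eq [Tau, Tau] []"
| tau_delta3: "ribbon_eq [Tau, Delta, Tau, Delta, Tau, Delta] []"

quotient_type ribbon_op = "ribbon_gen list" / ribbon_eq
  by (rule equivpI) (auto intro: reflpI sympI transpI ribbon_eq.refl ribbon_eq.sym ribbon_eq.trans)

instantiation ribbon_op :: monoid_mult
begin

lift_definition one_ribbon_op :: ribbon_op is "[]" .

lift_definition times_ribbon_op :: "ribbon_op \<Rightarrow> ribbon_op \<Rightarrow> ribbon_op" is "(@)"
  by (rule ribbon_eq.app)

instance
  by standard (transfer, simp add: ribbon_eq.refl)+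

end

text \<open>The partial dual joins the head of the first arrow to the tail of the second one, and the
  head of the second to the tail of the first; the arcs outside the arrows are unchanged.\<close>

fun gen_act :: "ribbon_gen \<Rightarrow> 'p arrow_pair \<Rightarrow> 'p arrow_pair" where
  "gen_act Tau ((a, b), (c, d)) = ((a, b), (d, c))"
| "gen_act Delta ((a, b), (c, d)) = ((b, c), (d, a))"

abbreviation word_act :: "ribbon_gen list \<Rightarrow> 'p arrow_pair \<Rightarrow> 'p arrow_pair" where
  "word_act w \<equiv> foldr gen_act w"

text \<open>The choice of a representing word only matters up to \<^const>\<open>same_arrows\<close>; see \<open>op_act_abs\<close>
  below.\<close>

definition op_act :: "ribbon_op \<Rightarrow> 'p arrow_pair \<Rightarrow> 'p arrow_pair" where
  "op_act s = word_act (rep_ribbon_op s)"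

definition apply_ops ::
  "nat \<Rightarrow> (nat \<Rightarrow> ribbon_op) \<Rightarrow> (nat \<Rightarrow> 'e) \<Rightarrow> ('e, 'p) ribbon_graph \<Rightarrow> ('e, 'p) ribbon_graph" where
  "apply_ops n \<gamma> l G =
     G\<lparr>arrows := \<lambda>e. op_act (\<gamma> (inv_into {1..n} l e)) (arrows G e)\<rparr>"


section \<open>The group action on ordered ribbon graphs\<close>

definition op_group :: "nat \<Rightarrow> ((nat \<Rightarrow> ribbon_op) \<times> (nat \<Rightarrow> nat)) monoid" where
  "op_group n =
     \<lparr>carrier = ({1..n} \<rightarrow>\<^sub>E UNIV) \<times> {\<pi>. \<pi> permutes {1..n}},
      mult = \<lambda>(\<gamma>\<^sub>1, \<pi>\<^sub>1) (\<gamma>\<^sub>2, \<pi>\<^sub>2).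
        (\<lambda>i\<in>{1..n}. \<gamma>\<^sub>1 i * \<gamma>\<^sub>2 (Hilbert_Choice.inv \<pi>\<^sub>1 i), \<pi>\<^sub>1 \<circ> \<pi>\<^sub>2),
      one = (\<lambda>i\<in>{1..n}. 1, id)\<rparr>"

definition pair_act :: "nat \<Rightarrow> (nat \<Rightarrow> ribbon_op) \<times> (nat \<Rightarrow> nat)
    \<Rightarrow> ('e, 'p) ordered_graph \<Rightarrow> ('e, 'p) ordered_graph" where
  "pair_act n = (\<lambda>(\<gamma>, \<pi>) (G, l).
     (apply_ops n \<gamma> (l \<circ> Hilbert_Choice.inv \<pi>) G, l \<circ> Hilbert_Choice.inv \<pi>))"

definition class_act :: "nat \<Rightarrow> (nat \<Rightarrow> ribbon_op) \<times> (nat \<Rightarrow> nat)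
    \<Rightarrow> ('e, 'p) ordered_graph set \<Rightarrow> ('e, 'p) ordered_graph set" where
  "class_act n x = (\<lambda>C\<in>G_or n. ordered_iso n `` (pair_act n x ` C))"


section \<open>Well-definedness\<close>

lemma same_arrows_refl: "same_arrows q q"
  by (cases q rule: arrow_ends.cases) auto

lemma same_arrows_sym: "same_arrows q r \<Longrightarrow> same_arrows r q"
  by (cases q rule: arrow_ends.cases; cases r rule: arrow_ends.cases) auto

lemma same_arrows_trans: "same_arrows q r \<Longrightarrow> same_arrows r s \<Longrightarrow> same_arrows q s"
  by (cases q rule: arrow_ends.cases; cases r rule: arrow_ends.cases) auto

lemma same_arrows_map: "same_arrows q r \<Longrightarrow> same_arrows (map_arrows f q) (map_arrows f r)"
  by (cases q rule: arrow_ends.cases; cases r rule: arrow_ends.cases) auto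

lemma same_arrows_ends: "same_arrows q r \<Longrightarrow> arrow_ends r = arrow_ends q"
  by (cases q rule: arrow_ends.cases; cases r rule: arrow_ends.cases) auto

lemma arrow_ends_map: "arrow_ends (map_arrows f q) = f ` arrow_ends q"
  by (cases q rule: arrow_ends.cases) auto

lemma gen_act_cong: "same_arrows q r \<Longrightarrow> same_arrows (gen_act x q) (gen_act x r)"
  by (cases x; cases q rule: arrow_ends.cases; cases r rule: arrow_ends.cases) auto

lemma gen_act_map: "gen_act x (map_arrows f q) = map_arrows f (gen_act x q)"
  by (cases x; cases q rule: arrow_ends.cases) auto

lemma gen_act_ends: "arrow_ends (gen_act x q) = arrow_ends q"
  by (cases x; cases q rule: arrow_ends.cases) auto

lemma word_act_cong: "same_arrows q r \<Longrightarrow> same_arrows (word_act w q) (word_act w r)"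
  by (induction w) (auto intro: gen_act_cong)

lemma word_act_map: "word_act w (map_arrows f q) = map_arrows f (word_act w q)"
  by (induction w) (auto simp: gen_act_map)

lemma word_act_ends: "arrow_ends (word_act w q) = arrow_ends q"
  by (induction w) (auto simp: gen_act_ends)

lemma word_act_ribbon_eq: "ribbon_eq u v \<Longrightarrow> same_arrows (word_act u q) (word_act v q)"
proof (induction arbitrary: q rule: ribbon_eq.induct)
  case (app u v u' v')
  have "same_arrows (word_act u (word_act u' q)) (word_act u (word_act v' q))"
    by (rule word_act_cong) (rule app.IH(2))
  moreover have "same_arrows (word_act u (word_act v' q)) (word_act v (word_act v' q))"
    by (rule app.IH(1))
  ultimately have "same_arrows (word_act u (word_act u' q)) (word_act v (word_act v' q))"
    by (rule same_arrows_trans)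
  then show ?case by (simp only: foldr_append comp_apply)
next
  case delta2 show ?case by (cases q rule: arrow_ends.cases) auto
next
  case tau2 show ?case by (cases q rule: arrow_ends.cases) auto
next
  case tau_delta3 show ?case by (cases q rule: arrow_ends.cases) auto
next
  case refl show ?case by (rule same_arrows_refl)
next
  case (sym u v) show ?case by (rule same_arrows_sym[OF sym.IH])
next
  case (trans u v w) show ?case by (rule same_arrows_trans[OF trans.IH])
qed

lemma ribbon_eq_rep_abs: "ribbon_eq (rep_ribbon_op (abs_ribbon_op w)) w"
  by (rule Quotient3_rep_abs[OF Quotient3_ribbon_op]) (rule ribbon_eq.refl)

lemma abs_rep_ribbon_op: "abs_ribbon_op (rep_ribbon_op s) = s"
  by (rule Quotient3_abs_rep[OF Quotient3_ribbon_op])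

lemma op_act_abs: "same_arrows (op_act (abs_ribbon_op w) q) (word_act w q)"
  unfolding op_act_def by (rule word_act_ribbon_eq[OF ribbon_eq_rep_abs])

lemma op_act_one: "same_arrows (op_act 1 q) q"
  using op_act_abs[of "[]" q] by (simp add: one_ribbon_op.abs_eq)

lemma op_act_mult: "same_arrows (op_act (s * t) q) (op_act s (op_act t q))"
proof -
  have "s * t = abs_ribbon_op (rep_ribbon_op s @ rep_ribbon_op t)"
    by (metis abs_rep_ribbon_op times_ribbon_op.abs_eq)
  then show ?thesis using op_act_abs by (metis foldr_append comp_apply op_act_def)
qed

lemma op_act_cong: "same_arrows q r \<Longrightarrow> same_arrows (op_act s q) (op_act s r)"
  unfolding op_act_def by (rule word_act_cong)

lemma op_act_map: "op_act s (map_arrows f q) = map_arrows f (op_act s q)"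
  unfolding op_act_def by (rule word_act_map)

lemma op_act_ends: "arrow_ends (op_act s q) = arrow_ends q"
  unfolding op_act_def by (rule word_act_ends)

lemma ribbon_op_left_inverse: "\<exists>t. t * s = (1::ribbon_op)"
proof -
  have "\<exists>v. ribbon_eq (v @ u) []" for u
  proof (induction u)
    case Nil show ?case by (auto intro: ribbon_eq.refl)
  next
    case (Cons x u)
    then obtain v where v: "ribbon_eq (v @ u) []" by blast
    have "ribbon_eq [x, x] []" by (cases x) (auto intro: ribbon_eq.delta2 ribbon_eq.tau2)
    then have "ribbon_eq (v @ [x, x] @ u) (v @ [] @ u)"
      by (intro ribbon_eq.app ribbon_eq.refl)
    then have "ribbon_eq ((v @ [x]) @ (x # u)) []"
      using ribbon_eq.trans[OF _ v] by simp
    then show ?case by blast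
  qed
  then show ?thesis by transfer
qed

lemma apply_ops_simps [simp]:
  "edges (apply_ops n \<gamma> l G) = edges G"
  "arc (apply_ops n \<gamma> l G) = arc G"
  "empty_circles (apply_ops n \<gamma> l G) = empty_circles G"
  "arrows (apply_ops n \<gamma> l G) e = op_act (\<gamma> (inv_into {1..n} l e)) (arrows G e)"
  "points (apply_ops n \<gamma> l G) = points G"
  by (simp_all add: apply_ops_def points_def op_act_ends)

lemma ribbon_graph_apply_ops: "ribbon_graph G \<Longrightarrow> ribbon_graph (apply_ops n \<gamma> l G)"
  unfolding ribbon_graph_def by (simp add: op_act_ends)

lemma arc_in_points: "ribbon_graph G \<Longrightarrow> p \<in> points G \<Longrightarrow> arc G p \<in> points G"
  unfolding ribbon_graph_def by blast

lemma ends_in_points: "e \<in> edges G \<Longrightarrow> arrow_ends (arrows G e) \<subseteq> points G"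
  unfolding points_def by blast

lemma map_arrows_cong:
  "(\<And>p. p \<in> arrow_ends q \<Longrightarrow> f p = g p) \<Longrightarrow> map_arrows f q = map_arrows g q"
  by (cases q rule: arrow_ends.cases) auto

lemma ribbon_iso_refl: "ribbon_iso id id G G"
  unfolding ribbon_iso_def by (auto simp: prod.map_id0 same_arrows_refl)

lemma ribbon_iso_sym:
  assumes G: "ribbon_graph G" and iso: "ribbon_iso g f G H"
  shows "ribbon_iso (inv_into (edges G) g) (inv_into (points G) f) H G"
  unfolding ribbon_iso_def
proof (intro conjI ballI)
  from iso have g: "bij_betw g (edges G) (edges H)" and f: "bij_betw f (points G) (points H)"
    unfolding ribbon_iso_def by auto
  show "bij_betw (inv_into (edges G) g) (edges H) (edges G)" by (rule bij_betw_inv_into[OF g])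
  show "bij_betw (inv_into (points G) f) (points H) (points G)" by (rule bij_betw_inv_into[OF f])
  show "empty_circles H = empty_circles G" using iso unfolding ribbon_iso_def by simp
  fix e assume e: "e \<in> edges H"
  define e' where "e' = inv_into (edges G) g e"
  have e': "e' \<in> edges G" "g e' = e"
    unfolding e'_def using g e by (auto simp: bij_betw_def inv_into_into f_inv_into_f)
  have "same_arrows (map_arrows f (arrows G e')) (arrows H e)"
    using iso e' unfolding ribbon_iso_def by auto
  then have "same_arrows (map_arrows (inv_into (points G) f) (map_arrows f (arrows G e')))
      (map_arrows (inv_into (points G) f) (arrows H e))" by (rule same_arrows_map)
  moreover have "map_arrows (inv_into (points G) f) (map_arrows f (arrows G e')) = arrows G e'"
  proof -
    have "map_arrows (inv_into (points G) f \<circ> f) (arrows G e') = map_arrows id (arrows G e')"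
      by (rule map_arrows_cong) (use f e' ends_in_points in \<open>fastforce simp: bij_betw_def\<close>)
    then show ?thesis by (simp add: prod.map_id0 prod.map_comp map_prod.comp)
  qed
  ultimately show "same_arrows (map_arrows (inv_into (points G) f) (arrows H e)) (arrows G (inv_into (edges G) g e))"
    using same_arrows_sym unfolding e'_def by metis
next
  fix p assume p: "p \<in> points H"
  from iso have f: "bij_betw f (points G) (points H)" unfolding ribbon_iso_def by auto
  define p' where "p' = inv_into (points G) f p"
  have p': "p' \<in> points G" "f p' = p"
    unfolding p'_def using f p by (auto simp: bij_betw_def inv_into_into f_inv_into_f)
  have "arc H p = f (arc G p')" using iso p' unfolding ribbon_iso_def by auto
  then show "inv_into (points G) f (arc H p) = arc G (inv_into (points G) f p)"
    using f arc_in_points[OF G p'(1)] unfolding p'_def by (simp add: bij_betw_def)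
qed

lemma ribbon_iso_trans:
  assumes 1: "ribbon_iso g f G H" and 2: "ribbon_iso g' f' H K"
  shows "ribbon_iso (g' \<circ> g) (f' \<circ> f) G K"
  unfolding ribbon_iso_def
proof (intro conjI ballI)
  show "bij_betw (g' \<circ> g) (edges G) (edges K)" "bij_betw (f' \<circ> f) (points G) (points K)"
    "empty_circles G = empty_circles K"
    using 1 2 unfolding ribbon_iso_def by (auto intro: bij_betw_trans)
  show "same_arrows (map_arrows (f' \<circ> f) (arrows G e)) (arrows K ((g' \<circ> g) e))"
    if "e \<in> edges G" for e
  proof -
    have "g e \<in> edges H" using 1 that unfolding ribbon_iso_def bij_betw_def by auto
    then have "same_arrows (map_arrows f' (arrows H (g e))) (arrows K (g' (g e)))"
      using 2 unfolding ribbon_iso_def by auto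
    moreover have "same_arrows (map_arrows f' (map_arrows f (arrows G e))) (map_arrows f' (arrows H (g e)))"
      using 1 that unfolding ribbon_iso_def by (auto intro: same_arrows_map)
    ultimately have "same_arrows (map_arrows f' (map_arrows f (arrows G e))) (arrows K (g' (g e)))"
      using same_arrows_trans by blast
    then show ?thesis by (simp add: prod.map_comp map_prod.comp)
  qed
  show "(f' \<circ> f) (arc G p) = arc K ((f' \<circ> f) p)" if "p \<in> points G" for p
    using 1 2 that unfolding ribbon_iso_def bij_betw_def by auto
qed

lemma equiv_ordered_iso: "equiv (ordered_pairs n) (ordered_iso n)"
proof (rule equivI)
  show "ordered_iso n \<subseteq> ordered_pairs n \<times> ordered_pairs n" unfolding ordered_iso_def by auto
  show "refl_on (ordered_pairs n) (ordered_iso n)"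
    unfolding refl_on_def ordered_iso_def using ribbon_iso_refl by fastforce
  show "sym (ordered_iso n)"
  proof (rule symI)
    fix x y :: "('e, 'p) ordered_graph"
    assume xy: "(x, y) \<in> ordered_iso n"
    obtain G l H m where x: "x = (G, l)" and y: "y = (H, m)" by (metis surj_pair)
    from xy obtain g f where iso: "ribbon_iso g f G H" and gl: "\<forall>i\<in>{1..n}. g (l i) = m i"
      and mem: "(G, l) \<in> ordered_pairs n" "(H, m) \<in> ordered_pairs n"
      unfolding ordered_iso_def x y by auto
    from mem have G: "ribbon_graph G" and l: "bij_betw l {1..n} (edges G)"
      unfolding ordered_pairs_def by auto
    have "inv_into (edges G) g (m i) = l i" if "i \<in> {1..n}" for i
    proof -
      have "l i \<in> edges G" using l that unfolding bij_betw_def by auto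
      then show ?thesis using gl iso that unfolding ribbon_iso_def bij_betw_def
        by (metis inv_into_f_f)
    qed
    then show "(y, x) \<in> ordered_iso n"
      unfolding ordered_iso_def x y using ribbon_iso_sym[OF G iso] mem by blast
  qed
  show "trans (ordered_iso n)"
  proof (rule transI)
    fix x y z :: "('e, 'p) ordered_graph"
    assume xy: "(x, y) \<in> ordered_iso n" and yz: "(y, z) \<in> ordered_iso n"
    obtain G l H m K k where x: "x = (G, l)" and y: "y = (H, m)" and z: "z = (K, k)"
      by (metis surj_pair)
    from xy obtain g f where 1: "ribbon_iso g f G H" "\<forall>i\<in>{1..n}. g (l i) = m i"
      unfolding ordered_iso_def x y by auto
    from yz obtain g' f' where 2: "ribbon_iso g' f' H K" "\<forall>i\<in>{1..n}. g' (m i) = k i"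
      unfolding ordered_iso_def y z by auto
    have "\<forall>i\<in>{1..n}. (g' \<circ> g) (l i) = k i" using 1 2 by simp
    with ribbon_iso_trans[OF 1(1) 2(1)] show "(x, z) \<in> ordered_iso n"
      using xy yz unfolding ordered_iso_def x y z by blast
  qed
qed

lemma bij_order_permute:
  "bij_betw l {1..n} E \<Longrightarrow> \<pi> permutes {1..n} \<Longrightarrow> bij_betw (l \<circ> Hilbert_Choice.inv \<pi>) {1..n} E"
  by (meson bij_betw_trans permutes_imp_bij permutes_inv)

lemma pair_act_closed:
  "x \<in> carrier (op_group n) \<Longrightarrow> y \<in> ordered_pairs n \<Longrightarrow> pair_act n x y \<in> ordered_pairs n"
  by (auto simp: op_group_def ordered_pairs_def pair_act_def ribbon_graph_apply_ops
      simp del: One_nat_def intro: bij_order_permute)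

lemma same_arrows_imp_ordered_iso:
  assumes "(G, l) \<in> ordered_pairs n" "(H, m) \<in> ordered_pairs n" "edges H = edges G"
    "arc H = arc G" "empty_circles H = empty_circles G"
    "\<And>e. e \<in> edges G \<Longrightarrow> same_arrows (arrows G e) (arrows H e)" "\<And>i. i \<in> {1..n} \<Longrightarrow> l i = m i"
  shows "((G, l), (H, m)) \<in> ordered_iso n"
proof -
  have "points H = points G"
    unfolding points_def assms(3) by (rule SUP_cong) (auto dest!: assms(6) same_arrows_ends)
  then have "ribbon_iso id id G H"
    unfolding ribbon_iso_def prod.map_id0 id_apply using assms(3-6) by (simp add: bij_betw_def)
  then show ?thesis using assms(1,2,7) unfolding ordered_iso_def by auto
qed

lemma pair_act_cong:
  assumes x: "x \<in> carrier (op_group n)" and yz: "(y, z) \<in> ordered_iso n"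
  shows "(pair_act n x y, pair_act n x z) \<in> ordered_iso n"
proof -
  obtain \<gamma> \<pi> G l H m where eqs: "x = (\<gamma>, \<pi>)" "y = (G, l)" "z = (H, m)" by (metis surj_pair)
  from yz obtain g f where iso: "ribbon_iso g f G H" and gl: "\<forall>i\<in>{1..n}. g (l i) = m i"
    and mem: "y \<in> ordered_pairs n" "z \<in> ordered_pairs n"
    unfolding ordered_iso_def eqs by auto
  from x have \<pi>: "Hilbert_Choice.inv \<pi> permutes {1..n}"
    unfolding op_group_def eqs by (auto intro: permutes_inv)
  define l' m' where "l' = l \<circ> Hilbert_Choice.inv \<pi>" and "m' = m \<circ> Hilbert_Choice.inv \<pi>"
  have l': "bij_betw l' {1..n} (edges G)" and m': "bij_betw m' {1..n} (edges H)"
    using mem x unfolding l'_def m'_def ordered_pairs_def eqs op_group_def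
    by (auto simp del: One_nat_def intro: bij_order_permute)
  have gl': "g (l' i) = m' i" if "i \<in> {1..n}" for i
    using gl permutes_in_image[OF \<pi>] that unfolding l'_def m'_def by simp
  have inv_eq: "inv_into {1..n} m' (g e) = inv_into {1..n} l' e" if "e \<in> edges G" for e
  proof -
    obtain i where i: "i \<in> {1..n}" "e = l' i" using l' \<open>e \<in> edges G\<close> unfolding bij_betw_def by (metis imageE)
    then have "g e = m' i" using gl' by simp
    then show ?thesis using i l' m' unfolding bij_betw_def by (metis inv_into_f_f)
  qed
  have "ribbon_iso g f (apply_ops n \<gamma> l' G) (apply_ops n \<gamma> m' H)"
    unfolding ribbon_iso_def
  proof (intro conjI ballI)
    fix e assume e: "e \<in> edges (apply_ops n \<gamma> l' G)"
    then have "same_arrows (map_arrows f (arrows G e)) (arrows H (g e))"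
      using iso unfolding ribbon_iso_def by auto
    then show "same_arrows (map_arrows f (arrows (apply_ops n \<gamma> l' G) e)) (arrows (apply_ops n \<gamma> m' H) (g e))"
      using inv_eq[of e] e op_act_cong unfolding apply_ops_simps by (metis op_act_map)
  qed (use iso in \<open>simp_all add: ribbon_iso_def\<close>)
  then show ?thesis
    using pair_act_closed[OF x mem(1)] pair_act_closed[OF x mem(2)] gl'
    unfolding ordered_iso_def eqs pair_act_def l'_def m'_def by auto
qed

lemma op_group_simps:
  "(\<gamma>, \<pi>) \<in> carrier (op_group n) \<longleftrightarrow> \<gamma> \<in> {1..n} \<rightarrow>\<^sub>E UNIV \<and> \<pi> permutes {1..n}"
  "(\<gamma>, \<pi>) \<otimes>\<^bsub>op_group n\<^esub> (\<gamma>', \<pi>') = (\<lambda>i\<in>{1..n}. \<gamma> i * \<gamma>' (Hilbert_Choice.inv \<pi> i), \<pi> \<circ> \<pi>')"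
  "\<one>\<^bsub>op_group n\<^esub> = (\<lambda>i\<in>{1..n}. 1, id)"
  by (simp_all add: op_group_def)

lemma group_op_group: "group (op_group n)"
proof (rule groupI)
  fix x y assume "x \<in> carrier (op_group n)" "y \<in> carrier (op_group n)"
  then show "x \<otimes>\<^bsub>op_group n\<^esub> y \<in> carrier (op_group n)"
    by (cases x; cases y) (auto simp: op_group_simps intro: permutes_compose)
next
  show "\<one>\<^bsub>op_group n\<^esub> \<in> carrier (op_group n)"
    by (auto simp: op_group_simps permutes_id)
next
  fix x y z
  assume x: "x \<in> carrier (op_group n)" and y: "y \<in> carrier (op_group n)" and "z \<in> carrier (op_group n)"
  obtain \<gamma> \<pi> \<gamma>' \<pi>' \<gamma>'' \<pi>'' where eqs: "x = (\<gamma>, \<pi>)" "y = (\<gamma>', \<pi>')" "z = (\<gamma>'', \<pi>'')"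
    by (metis surj_pair)
  have p: "\<pi> permutes {1..n}" "\<pi>' permutes {1..n}" using x y by (auto simp: eqs op_group_simps)
  have "Hilbert_Choice.inv (\<pi> \<circ> \<pi>') = Hilbert_Choice.inv \<pi>' \<circ> Hilbert_Choice.inv \<pi>"
    using p by (simp add: o_inv_distrib permutes_bij)
  moreover have "Hilbert_Choice.inv \<pi> i \<in> {1..n} \<longleftrightarrow> i \<in> {1..n}" for i
    using permutes_in_image[OF permutes_inv[OF p(1)]] .
  ultimately show "x \<otimes>\<^bsub>op_group n\<^esub> y \<otimes>\<^bsub>op_group n\<^esub> z = x \<otimes>\<^bsub>op_group n\<^esub> (y \<otimes>\<^bsub>op_group n\<^esub> z)"
    unfolding eqs op_group_simps prod.inject
    by (intro conjI restrict_ext) (simp_all add: mult.assoc o_assoc del: atLeastAtMost_iff)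
next
  fix x assume "x \<in> carrier (op_group n)"
  then show "\<one>\<^bsub>op_group n\<^esub> \<otimes>\<^bsub>op_group n\<^esub> x = x"
    by (cases x) (auto simp: op_group_simps PiE_def extensional_def restrict_def fun_eq_iff)
next
  fix x assume x: "x \<in> carrier (op_group n)"
  obtain \<gamma> \<pi> where eq: "x = (\<gamma>, \<pi>)" by (metis surj_pair)
  have \<pi>: "\<pi> permutes {1..n}" using x by (auto simp: eq op_group_simps)
  have bij: "bij \<pi>" using \<pi> by (rule permutes_bij)
  obtain t where t: "\<And>s::ribbon_op. t s * s = 1" using ribbon_op_left_inverse by metis
  have mem: "((\<lambda>i\<in>{1..n}. t (\<gamma> (\<pi> i))), Hilbert_Choice.inv \<pi>) \<in> carrier (op_group n)"
    using \<pi> by (auto simp: op_group_simps permutes_inv)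
  have "((\<lambda>i\<in>{1..n}. t (\<gamma> (\<pi> i))), Hilbert_Choice.inv \<pi>) \<otimes>\<^bsub>op_group n\<^esub> x = \<one>\<^bsub>op_group n\<^esub>"
    unfolding eq op_group_simps prod.inject
    by (intro conjI restrict_ext) (simp_all add: inv_inv_eq[OF bij] t permutes_inv_o[OF \<pi>])
  with mem show "\<exists>y\<in>carrier (op_group n). y \<otimes>\<^bsub>op_group n\<^esub> x = \<one>\<^bsub>op_group n\<^esub>" by blast
qed

lemma pair_act_one:
  assumes "y \<in> ordered_pairs n"
  shows "(pair_act n \<one>\<^bsub>op_group n\<^esub> y, y) \<in> ordered_iso n"
proof -
  obtain G l where y: "y = (G, l)" by (metis surj_pair)
  have l: "bij_betw l {1..n} (edges G)" using assms unfolding y ordered_pairs_def by auto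
  have closed: "pair_act n \<one>\<^bsub>op_group n\<^esub> y \<in> ordered_pairs n"
    by (rule pair_act_closed[OF monoid.one_closed[OF group.is_monoid[OF group_op_group]] assms])
  have "inv_into {1..n} l e \<in> {1..n}" if "e \<in> edges G" for e
    using that l unfolding bij_betw_def by (metis inv_into_into)
  then show ?thesis
    using closed assms unfolding y pair_act_def op_group_simps
    by (auto intro!: same_arrows_imp_ordered_iso simp: op_act_one simp del: atLeastAtMost_iff)
qed

lemma pair_act_mult:
  assumes x: "x \<in> carrier (op_group n)" and x': "x' \<in> carrier (op_group n)"
    and y: "y \<in> ordered_pairs n"
  shows "(pair_act n (x \<otimes>\<^bsub>op_group n\<^esub> x') y, pair_act n x (pair_act n x' y)) \<in> ordered_iso n"
proof -
  obtain \<gamma> \<pi> \<gamma>' \<pi>' G l where eqs: "x = (\<gamma>, \<pi>)" "x' = (\<gamma>', \<pi>')" "y = (G, l)" by (metis surj_pair)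
  have p: "\<pi> permutes {1..n}" "\<pi>' permutes {1..n}" using x x' by (auto simp: eqs op_group_simps)
  have l: "bij_betw l {1..n} (edges G)" using y unfolding eqs ordered_pairs_def by auto
  define k k' where "k = l \<circ> Hilbert_Choice.inv \<pi>'" and "k' = k \<circ> Hilbert_Choice.inv \<pi>"
  have k: "bij_betw k {1..n} (edges G)" unfolding k_def by (rule bij_order_permute[OF l p(2)])
  have k': "bij_betw k' {1..n} (edges G)" unfolding k'_def by (rule bij_order_permute[OF k p(1)])
  have kk: "l \<circ> Hilbert_Choice.inv (\<pi> \<circ> \<pi>') = k'"
    unfolding k_def k'_def using p by (simp add: o_inv_distrib permutes_bij o_assoc)
  have closed: "pair_act n (x \<otimes>\<^bsub>op_group n\<^esub> x') y \<in> ordered_pairs n"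
      "pair_act n x (pair_act n x' y) \<in> ordered_pairs n"
    using x x' y by (auto intro!: pair_act_closed monoid.m_closed[OF group.is_monoid[OF group_op_group]])
  show ?thesis
    using closed unfolding eqs pair_act_def op_group_simps prod.case kk k_def[symmetric] k'_def[symmetric]
  proof (rule same_arrows_imp_ordered_iso)
    fix e
    assume "e \<in> edges (apply_ops n (\<lambda>i\<in>{1..n}. \<gamma> i * \<gamma>' (Hilbert_Choice.inv \<pi> i)) k' G)"
    then obtain i where i: "i \<in> {1..n}" "e = k' i"
      using k' unfolding bij_betw_def apply_ops_simps by (metis imageE)
    have pi: "Hilbert_Choice.inv \<pi> i \<in> {1..n}"
      using permutes_in_image[OF permutes_inv[OF p(1)]] i by blast
    have "inv_into {1..n} k' e = i"
      using inv_into_f_f[OF bij_betw_imp_inj_on[OF k'] i(1)] i(2) by simp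
    moreover have "inv_into {1..n} k e = Hilbert_Choice.inv \<pi> i"
      using inv_into_f_f[OF bij_betw_imp_inj_on[OF k] pi] i(2) unfolding k'_def by simp
    ultimately show "same_arrows
        (arrows (apply_ops n (\<lambda>i\<in>{1..n}. \<gamma> i * \<gamma>' (Hilbert_Choice.inv \<pi> i)) k' G) e)
        (arrows (apply_ops n \<gamma> k' (apply_ops n \<gamma>' k G)) e)"
      using i(1) by (simp add: op_act_mult del: atLeastAtMost_iff)
  qed simp_all
qed

lemma iso_class_in_G_or: "y \<in> ordered_pairs n \<Longrightarrow> iso_class n y \<in> G_or n"
  unfolding iso_class_def G_or_def by (rule quotientI)

lemma G_or_cases:
  assumes "C \<in> G_or n" obtains y where "y \<in> ordered_pairs n" "C = iso_class n y"
  using assms unfolding G_or_def iso_class_def by (rule quotientE)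

lemma iso_class_eq: "(y, z) \<in> ordered_iso n \<Longrightarrow> iso_class n y = iso_class n z"
  unfolding iso_class_def by (rule equiv_class_eq[OF equiv_ordered_iso])

lemma class_act_iso_class:
  assumes x: "x \<in> carrier (op_group n)" and y: "y \<in> ordered_pairs n"
  shows "class_act n x (iso_class n y) = iso_class n (pair_act n x y)"
proof -
  have eq: "iso_class n (pair_act n x z) = iso_class n (pair_act n x y)" if "z \<in> iso_class n y" for z
  proof -
    have "(y, z) \<in> ordered_iso n" using that unfolding iso_class_def by simp
    then show ?thesis by (rule iso_class_eq[OF pair_act_cong[OF x], symmetric])
  qed
  have self: "y \<in> iso_class n y"
    unfolding iso_class_def by (rule equiv_class_self[OF equiv_ordered_iso y])
  have "ordered_iso n `` (pair_act n x ` iso_class n y)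
      = (\<Union>z\<in>iso_class n y. iso_class n (pair_act n x z))"
    by (subst Image_eq_UN) (simp add: iso_class_def)
  also have "\<dots> = (\<Union>z\<in>iso_class n y. iso_class n (pair_act n x y))"
    by (rule SUP_cong[OF HOL.refl eq])
  also have "\<dots> = iso_class n (pair_act n x y)"
    using self by (intro UN_constant_eq) auto
  finally show ?thesis unfolding class_act_def using iso_class_in_G_or[OF y] by simp
qed

lemma group_action_class_act:
  "group_action (op_group n) (G_or n :: ('e, 'p) ordered_graph set set) (class_act n)"
proof -
  interpret group "op_group n" by (rule group_op_group)
  have closed: "class_act n x C \<in> G_or n"
    if x: "x \<in> carrier (op_group n)" and C: "C \<in> G_or n" for x and C :: "('e, 'p) ordered_graph set"
  proof -
    obtain y where y: "y \<in> ordered_pairs n" "C = iso_class n y" using C by (rule G_or_cases)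
    show ?thesis unfolding y(2) class_act_iso_class[OF x y(1)]
      by (rule iso_class_in_G_or[OF pair_act_closed[OF x y(1)]])
  qed
  have mult: "class_act n (x \<otimes>\<^bsub>op_group n\<^esub> x') C = class_act n x (class_act n x' C)"
    if x: "x \<in> carrier (op_group n)" and x': "x' \<in> carrier (op_group n)" and C: "C \<in> G_or n" for x x' and C :: "('e, 'p) ordered_graph set"
  proof -
    obtain y where y: "y \<in> ordered_pairs n" "C = iso_class n y" using C by (rule G_or_cases)
    show ?thesis
      unfolding y(2) class_act_iso_class[OF x' y(1)] class_act_iso_class[OF m_closed[OF x x'] y(1)]
        class_act_iso_class[OF x pair_act_closed[OF x' y(1)]]
      by (rule iso_class_eq[OF pair_act_mult[OF x x' y(1)]])
  qed
  have one: "class_act n \<one>\<^bsub>op_group n\<^esub> C = C" if C: "C \<in> G_or n" for C :: "('e, 'p) ordered_graph set"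
  proof -
    obtain y where y: "y \<in> ordered_pairs n" "C = iso_class n y" using C by (rule G_or_cases)
    show ?thesis unfolding y(2) class_act_iso_class[OF one_closed y(1)]
      by (rule iso_class_eq[OF pair_act_one[OF y(1)]])
  qed
  have bij: "class_act n x \<in> Bij (G_or n :: ('e, 'p) ordered_graph set set)" if x: "x \<in> carrier (op_group n)" for x
  proof -
    have "bij_betw (class_act n x) (G_or n :: ('e, 'p) ordered_graph set set) (G_or n)"
      by (rule bij_betw_byWitness[where f' = "class_act n (inv\<^bsub>op_group n\<^esub> x)"])
        (use x in \<open>auto simp: closed one simp flip: mult\<close>)
    then show ?thesis unfolding Bij_def by (simp add: class_act_def)
  qed
  show ?thesis
    unfolding group_action_def group_hom_def group_hom_axioms_def hom_def
  proof (intro conjI CollectI ballI)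
    show "class_act n \<in> carrier (op_group n) \<rightarrow> carrier (BijGroup (G_or n :: ('e, 'p) ordered_graph set set))"
      by (rule Pi_I) (simp add: BijGroup_def bij)
    fix x x' assume x: "x \<in> carrier (op_group n)" and x': "x' \<in> carrier (op_group n)"
    have "class_act n (x \<otimes>\<^bsub>op_group n\<^esub> x') C = compose (G_or n) (class_act n x) (class_act n x') C" for C :: "('e, 'p) ordered_graph set"
      by (cases "C \<in> G_or n") (simp_all add: compose_def mult[OF x x'], simp add: class_act_def)
    then show "(class_act n (x \<otimes>\<^bsub>op_group n\<^esub> x')
          :: ('e, 'p) ordered_graph set \<Rightarrow> ('e, 'p) ordered_graph set) =
        class_act n x \<otimes>\<^bsub>BijGroup (G_or n)\<^esub> class_act n x'"
      by (simp add: BijGroup_def bij[OF x] bij[OF x'] fun_eq_iff)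
  qed (simp_all add: group_BijGroup)
qed

end

theory Submission
  imports Defs
begin

text \<open>Only the four points of an edge and the way in which its operations rearrange them matter. The
  four ends of an edge have three perfect matchings: the two arrows, the two segments that partial
  duality would draw, and a third one. The vertex circles are the cycles formed by the arcs together
  with the arrows.

  First, the operations can make all circles into one. If the arrows \<open>ab\<close> and \<open>cd\<close> of an edge lie on
  different circles, the partial dual replaces them by \<open>bc\<close> and \<open>da\<close> and fuses the two circles, as
  \<open>circles_merge\<close> shows. In a connected ribbon graph such an edge exists as long as there is more
  than one circle (\<open>all_points_on_one_circle\<close>), so a choice of operations for which the relation of
  lying on a common circle is as large as possible leaves a single vertex. This is the argument that
  every connected 4-regular graph has an Eulerian circuit.

  Second, the points of a single circle can be coloured alternately with two colours
  (\<open>alternating_colouring\<close>). Each arrow then has ends of both colours, and the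
  surface is orientable when the tails of the two arrows of each edge agree in colour. A twist
  reverses one of these arrows, which leaves the circle unchanged and corrects any edge at which
  the tails disagree.\<close>

section \<open>Two pairings of a finite set\<close>

definition pairing :: "'p set \<Rightarrow> ('p \<Rightarrow> 'p) \<Rightarrow> bool" where
  "pairing P m \<longleftrightarrow> (\<forall>p\<in>P. m p \<in> P \<and> m p \<noteq> p \<and> m (m p) = p)"

definition links :: "'p set \<Rightarrow> ('p \<Rightarrow> 'p) \<Rightarrow> ('p \<Rightarrow> 'p) \<Rightarrow> 'p rel" where
  "links P a m = {(p, q). p \<in> P \<and> (q = a p \<or> q = m p)}"

lemma even_card_pairing: "finite K \<Longrightarrow> pairing K m \<Longrightarrow> even (card K)"
proof (induction "card K" arbitrary: K rule: less_induct)
  case less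
  show ?case
  proof (cases "K = {}")
    case False
    then obtain p where p: "p \<in> K" by blast
    have m: "m p \<in> K" "m p \<noteq> p" using less.prems p unfolding pairing_def by auto
    have card: "card K = card (K - {p, m p}) + 2"
      using card_Diff_subset[of "{p, m p}" K] card_mono[of K "{p, m p}"] p m less.prems(1) by auto
    have "pairing (K - {p, m p}) m"
      using less.prems(2) p unfolding pairing_def by (metis Diff_iff insert_iff empty_iff)
    then have "even (card (K - {p, m p}))" using less.hyps less.prems(1) card by auto
    then show ?thesis using card by simp
  qed simp
qed

lemma sym_links: "pairing P a \<Longrightarrow> pairing P m \<Longrightarrow> sym (links P a m)"
  unfolding pairing_def links_def by (auto intro!: symI)

text \<open>Parity: a set \<open>K\<close> closed under the arcs is even, and so is its part outside \<open>{x, y}\<close> if it is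
  closed under the other pairing there.\<close>

lemma both_or_neither_end:
  assumes "finite K" "pairing K a" "pairing (K - {x, y}) m" "x \<in> K"
  shows "y \<in> K"
proof (rule ccontr)
  assume "y \<notin> K"
  then have "K - {x, y} = K - {x}" by blast
  then have "card K = Suc (card (K - {x, y}))" using assms(1,4) card_Suc_Diff1[of K x] by simp
  then show False
    using even_card_pairing[OF assms(1,2)] even_card_pairing[OF _ assms(3)] assms(1) by simp
qed

text \<open>Cutting the circle through \<open>x\<close> at the pair \<open>{x, m x}\<close> leaves a path between \<open>x\<close> and \<open>m x\<close>.
  By parity, the set of points that remain joined to \<open>x\<close> cannot contain just one of them. It
  does not meet the circle of \<open>z\<close>, so cutting the pair \<open>{z, m z}\<close> as well makes no difference.\<close>

lemma cut_circle_is_path: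
  assumes "finite P" "pairing P a" "pairing P m" "x \<in> P" "z \<in> P"
    and sep: "(x, z) \<notin> (links P a m)\<^sup>*"
    and R: "R = {(p, q). p \<in> P \<and> (q = a p \<or> p \<notin> {x, m x, z, m z} \<and> q = m p)}"
  shows "(x, m x) \<in> R\<^sup>*"
proof -
  define K where "K = R\<^sup>* `` {x}"
  have RL: "R\<^sup>* \<subseteq> (links P a m)\<^sup>*" unfolding R links_def by (rule rtrancl_mono) auto
  have step: "q \<in> K" if "p \<in> K" "(p, q) \<in> R" for p q
    using that unfolding K_def by (auto intro: rtrancl_into_rtrancl)
  have KP: "K \<subseteq> P"
  proof
    fix p assume "p \<in> K"
    then have "(x, p) \<in> R\<^sup>*" unfolding K_def by simp
    then show "p \<in> P"
      by (induction rule: rtrancl_induct) (use assms(2-4) in \<open>auto simp: R pairing_def\<close>)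
  qed
  have z: "z \<notin> K" using sep RL unfolding K_def by blast
  have mz: "m z \<notin> K"
  proof
    assume "m z \<in> K"
    then have "(x, m z) \<in> (links P a m)\<^sup>*" using RL unfolding K_def by blast
    moreover have "(m z, z) \<in> links P a m" using assms(3,5) unfolding links_def pairing_def by auto
    ultimately show False using sep by (meson rtrancl_into_rtrancl)
  qed
  have "pairing K a"
    unfolding pairing_def
  proof
    fix p assume p: "p \<in> K"
    then have "(p, a p) \<in> R" using KP unfolding R by auto
    with p KP show "a p \<in> K \<and> a p \<noteq> p \<and> a (a p) = p"
      using step assms(2) unfolding pairing_def by blast
  qed
  moreover have "pairing (K - {x, m x}) m"
    unfolding pairing_def
  proof
    fix p assume p: "p \<in> K - {x, m x}"
    then have "p \<in> P" using KP by blast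
    then have m: "m p \<in> P" "m p \<noteq> p" "m (m p) = p" using assms(3) unfolding pairing_def by auto
    have "(p, m p) \<in> R" using p \<open>p \<in> P\<close> z mz unfolding R by auto
    then have "m p \<in> K" using step p by blast
    moreover have "m p \<noteq> x" "m p \<noteq> m x" using p m assms(3,4) unfolding pairing_def by auto
    ultimately show "m p \<in> K - {x, m x} \<and> m p \<noteq> p \<and> m (m p) = p" using m by simp
  qed
  moreover have "finite K" "x \<in> K" using assms(1) KP unfolding K_def by (auto intro: finite_subset)
  ultimately have "m x \<in> K" using both_or_neither_end by metis
  then show ?thesis unfolding K_def by simp
qed

text \<open>Cut the circles at \<open>{x, m x}\<close> and \<open>{z, m z}\<close>; the two resulting paths are tied together at
  their ends by the new pairs. So the new circles still join whatever the old ones joined.\<close>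

lemma circles_merge:
  assumes P: "finite P" "pairing P a" "pairing P m" "pairing P m'" "x \<in> P" "z \<in> P"
    and sep: "(x, z) \<notin> (links P a m)\<^sup>*"
    and off: "\<And>p. p \<in> P \<Longrightarrow> p \<notin> {x, m x, z, m z} \<Longrightarrow> m' p = m p"
    and new: "m' (m x) = z"
  shows "(links P a m)\<^sup>* \<subseteq> (links P a m')\<^sup>*" "(x, z) \<in> (links P a m')\<^sup>*"
proof -
  define R where "R = {(p, q). p \<in> P \<and> (q = a p \<or> p \<notin> {x, m x, z, m z} \<and> q = m p)}"
  have R': "{(p, q). p \<in> P \<and> (q = a p \<or> p \<notin> {z, m z, x, m x} \<and> q = m p)} = R"
    unfolding R_def by auto
  have sep': "(z, x) \<notin> (links P a m)\<^sup>*"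
    using sep sym_rtrancl[OF sym_links[OF P(2,3)]] by (meson symD)
  let ?T = "(links P a m')\<^sup>*"
  have "R \<subseteq> links P a m'" unfolding R_def links_def using off by auto
  then have RT: "R\<^sup>* \<subseteq> ?T" by (rule rtrancl_mono)
  have sT: "(q, p) \<in> ?T" if "(p, q) \<in> ?T" for p q
    using that sym_rtrancl[OF sym_links[OF P(2,4)]] by (meson symD)
  have xT: "(x, m x) \<in> ?T"
    using cut_circle_is_path[OF P(1-3,5,6) sep R_def] RT by blast
  have zT: "(z, m z) \<in> ?T"
    using cut_circle_is_path[OF P(1-3,6,5) sep' R'[symmetric]] RT by blast
  have m: "m (m x) = x" "m (m z) = z" "m x \<in> P" using P(3,5,6) unfolding pairing_def by auto
  have "links P a m \<subseteq> ?T"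
  proof
    fix u assume "u \<in> links P a m"
    then obtain p q where u: "u = (p, q)" and p: "p \<in> P" and q: "q = a p \<or> q = m p"
      unfolding links_def by auto
    show "u \<in> ?T"
    proof (cases "u \<in> R")
      case False
      then have "q = m p" "p \<in> {x, m x, z, m z}" using p q unfolding R_def u by auto
      then show ?thesis using xT zT sT m unfolding u by auto
    qed (use RT in auto)
  qed
  then show "(links P a m)\<^sup>* \<subseteq> ?T" by (metis rtrancl_mono rtrancl_idemp)
  have "(m x, z) \<in> links P a m'" using m new unfolding links_def by auto
  then show "(x, z) \<in> ?T" using xT by (meson rtrancl_into_rtrancl)
qed

text \<open>Walking from \<open>p\<close> two links at a time never reaches the neighbour \<open>a p\<close>: otherwise, removing the
  first two and the last two links of the walk leaves a shorter counterexample, which starts at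
  \<open>m (a p)\<close>. The shortest ones would give fixed points of the pairings.\<close>

lemma even_walk_avoids_neighbour:
  assumes "pairing P a" "pairing P m" "p \<in> P"
  shows "((m \<circ> a) ^^ k) p \<noteq> a p"
  using assms(3)
proof (induction k arbitrary: p rule: less_induct)
  case (less k)
  have walk: "((m \<circ> a) ^^ j) q \<in> P" if "q \<in> P" for j q
    using that by (induction j) (use assms(1,2) in \<open>auto simp: pairing_def\<close>)
  consider "k = 0" | "k = 1" | j where "k = Suc (Suc j)"
    by (metis One_nat_def not0_implies_Suc)
  then show ?case
  proof cases
    case 3
    define q where "q = (m \<circ> a) p"
    have q: "q \<in> P" using walk[of p 1] less.prems unfolding q_def by simp
    let ?r = "((m \<circ> a) ^^ j) q"
    have "(f ^^ Suc (Suc j)) p = f ((f ^^ j) (f p))" for f :: "'a \<Rightarrow> 'a"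
      by (simp add: funpow_swap1)
    then have eq: "((m \<circ> a) ^^ k) p = m (a ?r)" unfolding 3 q_def by (metis comp_apply)
    show ?thesis
    proof
      assume "((m \<circ> a) ^^ k) p = a p"
      then have "m (m (a ?r)) = q" unfolding eq q_def by simp
      then have "a (a ?r) = a q" using walk[OF q, of j] assms(1,2) unfolding pairing_def by metis
      then have "?r = a q" using walk[OF q, of j] assms(1) unfolding pairing_def by metis
      then show False using less.IH[OF _ q, of j] 3 by simp
    qed
  qed (use assms(1,2) less.prems in \<open>auto simp: pairing_def\<close>)
qed

text \<open>One colour is given to the set \<open>E\<close> of the points reached from \<open>p\<close> in steps of two links. Such a
  step is injective, so it permutes the finite set \<open>E\<close>, and therefore both pairings map \<open>E\<close> onto the
  same set. It is disjoint from \<open>E\<close> because the steps never reach a neighbour, and together with \<open>E\<close>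
  it exhausts the circle.\<close>

lemma alternating_colouring:
  assumes P: "finite P" "pairing P a" "pairing P m" and p: "p \<in> P"
    and one: "P \<subseteq> (links P a m)\<^sup>* `` {p}"
  shows "\<exists>\<sigma> :: 'p \<Rightarrow> bool. \<forall>q\<in>P. \<sigma> (a q) \<noteq> \<sigma> q \<and> \<sigma> (m q) \<noteq> \<sigma> q"
proof -
  define f where "f = m \<circ> a"
  define E where "E = {(f ^^ k) p | k. True}"
  have fP: "f q \<in> P" if "q \<in> P" for q using that P unfolding f_def pairing_def by auto
  have EP: "E \<subseteq> P"
  proof -
    have "(f ^^ k) p \<in> P" for k by (induction k) (auto simp: p fP)
    then show ?thesis unfolding E_def by auto
  qed
  have fE: "f q \<in> E" if "q \<in> E" for q
    using that unfolding E_def by (auto intro: exI[of _ "Suc _"])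
  have inj: "inj_on f E"
    using EP P(2,3) unfolding f_def inj_on_def comp_apply pairing_def by (metis subsetD)
  have "f ` E = E" using endo_inj_surj[of E f] fE inj EP P(1) finite_subset by blast
  then have pred: "\<exists>r\<in>E. f r = q" if "q \<in> E" for q using that by (metis imageE)
  have mE: "\<exists>r\<in>E. m q = a r" if q: "q \<in> E" for q
  proof -
    obtain r where "r \<in> E" "f r = q" using pred[OF q] by blast
    then show ?thesis using EP P unfolding f_def pairing_def by (metis comp_apply subsetD)
  qed
  have disjoint: "a q \<notin> E" if q: "q \<in> E" for q
  proof
    assume "a q \<in> E"
    then obtain j where j: "a q = (f ^^ j) p" unfolding E_def by auto
    have surj: "\<exists>r\<in>E. (f ^^ i) r = s" if "s \<in> E" for s i
    proof (induction i)
      case (Suc i)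
      then obtain r where "r \<in> E" "(f ^^ i) r = s" by blast
      then show ?case using pred[of r] by (auto simp: funpow_swap1)
    qed (use that in auto)
    obtain i where i: "q = (f ^^ i) p" using q unfolding E_def by auto
    obtain r where r: "r \<in> E" "(f ^^ i) r = p"
      using surj[of p i] unfolding E_def by (metis (mono_tags, lifting) funpow_0 mem_Collect_eq)
    then obtain k where "r = (f ^^ k) p" unfolding E_def by auto
    then have loop: "(f ^^ (i + k)) p = p" using r by (simp add: funpow_add)
    have "(f ^^ (j + k)) q = (f ^^ j) ((f ^^ (i + k)) p)"
      unfolding i by (metis add.assoc add.commute comp_apply funpow_add)
    then have "(f ^^ (j + k)) q = a q" unfolding loop j .
    then show False using even_walk_avoids_neighbour[OF P(2,3)] EP q unfolding f_def by blast
  qed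
  have split: "q \<in> E \<or> (\<exists>r\<in>E. q = a r)" if "(p, q) \<in> (links P a m)\<^sup>*" for q
    using that
  proof (induction rule: rtrancl_induct)
    case base
    have "p \<in> E" unfolding E_def by (auto intro: exI[of _ 0])
    then show ?case by simp
  next
    case (step q s)
    have "s = a q \<or> s = m q" using step.hyps(2) unfolding links_def by auto
    then show ?case
    proof
      assume s: "s = a q"
      then show ?thesis using step.IH EP P(2) unfolding pairing_def by (metis subsetD)
    next
      assume s: "s = m q"
      then show ?thesis using step.IH mE fE unfolding f_def by auto
    qed
  qed
  have "(a q \<in> E) \<noteq> (q \<in> E) \<and> (m q \<in> E) \<noteq> (q \<in> E)" if q: "q \<in> P" for q
  proof (cases "q \<in> E")
    case True
    then show ?thesis using disjoint mE by metis
  next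
    case False
    then obtain r where r: "r \<in> E" "q = a r" using split one q by blast
    then have "a q = r" using EP P(2) unfolding pairing_def by auto
    then show ?thesis using r False fE[of r] unfolding f_def by simp
  qed
  then show ?thesis by (intro exI[of _ "\<lambda>q. q \<in> E"]) blast
qed

section \<open>Circles of a ribbon graph\<close>

definition partner :: "('e, 'p) ribbon_graph \<Rightarrow> 'p \<Rightarrow> 'p" where
  "partner G p = (THE q. \<exists>e\<in>edges G. (p, q) \<in> arrow_set (arrows G e) \<union> (arrow_set (arrows G e))\<inverse>)"

lemma edge_ends_distinct:
  assumes "ribbon_graph G" "e \<in> edges G" "arrows G e = ((a, b), (c, d))"
  shows "distinct [a, b, c, d]"
proof -
  have "card (arrow_ends (arrows G e)) = 4" using assms(1,2) unfolding ribbon_graph_def by blast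
  then have "card (set [a, b, c, d]) = length [a, b, c, d]" using assms(3) by simp
  then show ?thesis by (rule card_distinct)
qed

lemma arrow_set_ends:
  "(p, q) \<in> arrow_set r \<union> (arrow_set r)\<inverse> \<Longrightarrow> p \<in> arrow_ends r \<and> q \<in> arrow_ends r"
  by (cases r rule: arrow_ends.cases) auto

lemma partner_eq:
  assumes G: "ribbon_graph G" and e: "e \<in> edges G"
    and pq: "(p, q) \<in> arrow_set (arrows G e) \<union> (arrow_set (arrows G e))\<inverse>"
  shows "partner G p = q"
  unfolding partner_def
proof (rule the_equality)
  show "\<exists>e\<in>edges G. (p, q) \<in> arrow_set (arrows G e) \<union> (arrow_set (arrows G e))\<inverse>" using e pq by blast
  fix s assume "\<exists>e\<in>edges G. (p, s) \<in> arrow_set (arrows G e) \<union> (arrow_set (arrows G e))\<inverse>"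
  then obtain e' where e': "e' \<in> edges G"
    and ps: "(p, s) \<in> arrow_set (arrows G e') \<union> (arrow_set (arrows G e'))\<inverse>" by blast
  have "p \<in> arrow_ends (arrows G e) \<inter> arrow_ends (arrows G e')"
    using arrow_set_ends[OF pq] arrow_set_ends[OF ps] by blast
  then have e'_eq: "e' = e" using G e e' unfolding ribbon_graph_def by blast
  obtain a b c d where abcd: "arrows G e = ((a, b), (c, d))" by (metis surj_pair)
  show "s = q"
    using pq ps edge_ends_distinct[OF G e abcd] unfolding e'_eq abcd by auto
qed

lemma partner_arrows:
  assumes "ribbon_graph G" "e \<in> edges G" "arrows G e = ((a, b), (c, d))"
  shows "partner G a = b" "partner G b = a" "partner G c = d" "partner G d = c"
  using assms by (auto intro: partner_eq)

lemma pairing_arc: "ribbon_graph G \<Longrightarrow> pairing (points G) (arc G)"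
  unfolding ribbon_graph_def pairing_def by blast

lemma pairing_partner:
  assumes "ribbon_graph G"
  shows "pairing (points G) (partner G)"
  unfolding pairing_def
proof
  fix p assume "p \<in> points G"
  then obtain e where e: "e \<in> edges G" "p \<in> arrow_ends (arrows G e)" unfolding points_def by blast
  obtain a b c d where abcd: "arrows G e = ((a, b), (c, d))" by (metis surj_pair)
  have "{a, b, c, d} \<subseteq> points G" using ends_in_points[OF e(1)] abcd by simp
  moreover have "p \<in> {a, b, c, d}" using e(2) abcd by simp
  ultimately show "partner G p \<in> points G \<and> partner G p \<noteq> p \<and> partner G (partner G p) = p"
    using edge_ends_distinct[OF assms e(1) abcd] partner_arrows[OF assms e(1) abcd] by auto
qed

lemma circle_step_links:
  assumes G: "ribbon_graph G"
  shows "circle_step G = links (points G) (arc G) (partner G)"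
proof -
  let ?A = "\<Union>e\<in>edges G. arrow_set (arrows G e)"
  have mem: "(p, q) \<in> ?A \<union> ?A\<inverse> \<longleftrightarrow> p \<in> points G \<and> q = partner G p" for p q
  proof
    assume "(p, q) \<in> ?A \<union> ?A\<inverse>"
    then obtain e where e: "e \<in> edges G"
        "(p, q) \<in> arrow_set (arrows G e) \<union> (arrow_set (arrows G e))\<inverse>" by auto
    then show "p \<in> points G \<and> q = partner G p"
      using partner_eq[OF G e] arrow_set_ends[OF e(2)] ends_in_points[OF e(1)] by auto
  next
    assume pq: "p \<in> points G \<and> q = partner G p"
    then obtain e where e: "e \<in> edges G" "p \<in> arrow_ends (arrows G e)" unfolding points_def by blast
    obtain a b c d where abcd: "arrows G e = ((a, b), (c, d))" by (metis surj_pair)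
    have "(p, q) \<in> arrow_set (arrows G e) \<union> (arrow_set (arrows G e))\<inverse>"
      using partner_arrows[OF G e(1) abcd] e(2) pq abcd by auto
    then show "(p, q) \<in> ?A \<union> ?A\<inverse>" using e(1) by auto
  qed
  have A: "?A \<union> ?A\<inverse> = {(p, q). p \<in> points G \<and> q = partner G p}"
    by (rule Set.set_eqI) (simp only: mem split_paired_all mem_Collect_eq prod.case)
  have "circle_step G = {(p, arc G p) | p. p \<in> points G} \<union> (?A \<union> ?A\<inverse>)"
    unfolding circle_step_def Let_def by (simp only: Un_assoc)
  then show ?thesis unfolding A links_def by auto
qed

lemma finite_points: "ribbon_graph G \<Longrightarrow> finite (points G)"
  unfolding ribbon_graph_def points_def by (force intro: card_ge_0_finite)

lemma sym_circle_step: "ribbon_graph G \<Longrightarrow> sym (circle_step G)"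
  by (simp add: circle_step_links sym_links pairing_arc pairing_partner)

lemma circle_step_points:
  "ribbon_graph G \<Longrightarrow> (p, q) \<in> circle_step G \<Longrightarrow> p \<in> points G \<and> q \<in> points G"
  using pairing_arc[of G] pairing_partner[of G]
  by (auto simp: circle_step_links links_def pairing_def)

lemma no_empty_circles:
  assumes "connected_ribbon_graph G" "p \<in> points G"
  shows "empty_circles G = 0"
proof (rule ccontr)
  assume "empty_circles G \<noteq> 0"
  then have "Inr 0 \<in> vertices G" "vertex_at G p \<in> vertices G"
    using assms(2) unfolding vertices_def by auto
  then have "(vertex_at G p, Inr 0) \<in> (adjacent G)\<^sup>*"
    using assms(1) unfolding connected_ribbon_graph_def by blast
  then show False by (cases rule: rtranclE) (auto simp: adjacent_def vertex_at_def)
qed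

text \<open>Connectivity refers to the circles of \<open>G\<close>, but it is only used through the arcs and through the
  sets of ends of the edges, which the operations on edges do not change.\<close>

lemma connected_closed_set:
  assumes G: "ribbon_graph G" "connected_ribbon_graph G" and p: "p \<in> C" "p \<in> points G"
    and arc: "\<And>q. q \<in> C \<Longrightarrow> q \<in> points G \<Longrightarrow> arc G q \<in> C"
    and edge: "\<And>e q r. e \<in> edges G \<Longrightarrow> q \<in> arrow_ends (arrows G e) \<Longrightarrow> r \<in> arrow_ends (arrows G e)
      \<Longrightarrow> q \<in> C \<Longrightarrow> r \<in> C"
  shows "points G \<subseteq> C"
proof
  fix q assume q: "q \<in> points G"
  have step: "r \<in> C" if "(s, r) \<in> circle_step G" "s \<in> C" for s r
  proof -
    have s: "s \<in> points G" using circle_step_points[OF G(1) that(1)] by simp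
    have "r = arc G s \<or> (\<exists>e\<in>edges G. (s, r) \<in> arrow_set (arrows G e) \<union> (arrow_set (arrows G e))\<inverse>)"
      using that(1) unfolding circle_step_def Let_def by auto
    then show ?thesis using arc[OF that(2) s] edge[OF _ _ _ that(2)] arrow_set_ends by metis
  qed
  have circle: "r \<in> C" if "vertex_at G s = vertex_at G r" "s \<in> C" for s r
  proof -
    have "(s, r) \<in> (circle_step G)\<^sup>*" using that(1) unfolding vertex_at_def by auto
    then show ?thesis by (induction rule: rtrancl_induct) (use that(2) step in auto)
  qed
  have reach: "\<forall>r. v = vertex_at G r \<longrightarrow> r \<in> C" if "(vertex_at G p, v) \<in> (adjacent G)\<^sup>*" for v
    using that
  proof (induction rule: rtrancl_induct)
    case base show ?case using circle[OF _ p(1)] by simp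
  next
    case (step u v)
    then obtain r s e where rs: "u = vertex_at G r" "v = vertex_at G s" "e \<in> edges G"
      "r \<in> arrow_ends (arrows G e)" "s \<in> arrow_ends (arrows G e)" unfolding adjacent_def by auto
    then have "s \<in> C" using edge[OF rs(3-5)] step.IH by simp
    then show ?case using circle[of s] rs(2) by simp
  qed
  have "(vertex_at G p, vertex_at G q) \<in> (adjacent G)\<^sup>*"
    using G(2) p(2) q unfolding connected_ribbon_graph_def vertices_def by blast
  then show "q \<in> C" using reach by blast
qed

section \<open>Operations on the edges\<close>

definition act_words ::
  "('e \<Rightarrow> ribbon_gen list) \<Rightarrow> ('e, 'p) ribbon_graph \<Rightarrow> ('e, 'p) ribbon_graph" where
  "act_words w G = G\<lparr>arrows := \<lambda>e. word_act (w e) (arrows G e)\<rparr>"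

lemma act_words_simps [simp]:
  "edges (act_words w G) = edges G"
  "arc (act_words w G) = arc G"
  "empty_circles (act_words w G) = empty_circles G"
  "arrows (act_words w G) e = word_act (w e) (arrows G e)"
  "points (act_words w G) = points G"
  by (simp_all add: act_words_def points_def word_act_ends)

lemma ribbon_graph_act_words: "ribbon_graph G \<Longrightarrow> ribbon_graph (act_words w G)"
  unfolding ribbon_graph_def by (simp add: word_act_ends)

text \<open>A word and the representative of its class in the group act alike only up to
  \<^const>\<open>same_arrows\<close>, so the orbit contains the isomorphism class of the pair although the pair
  itself need not be the image of \<open>(G, l)\<close>.\<close>

lemma act_words_in_orbit:
  assumes Gl: "(G, l) \<in> ordered_pairs n"
  shows "(act_words w G, l) \<in> ordered_pairs n"
    and "iso_class n (act_words w G, l) \<in> orbit (op_group n) (class_act n) (iso_class n (G, l))"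
proof -
  have l: "bij_betw l {1..n} (edges G)" and G: "ribbon_graph G"
    using Gl unfolding ordered_pairs_def by auto
  show mem: "(act_words w G, l) \<in> ordered_pairs n"
    using Gl ribbon_graph_act_words[OF G] unfolding ordered_pairs_def by simp
  define x where "x = ((\<lambda>i\<in>{1..n}. abs_ribbon_op (w (l i))), id :: nat \<Rightarrow> nat)"
  have x: "x \<in> carrier (op_group n)" unfolding x_def op_group_simps by (auto simp: permutes_id)
  have "(pair_act n x (G, l), (act_words w G, l)) \<in> ordered_iso n"
  proof -
    have closed: "(apply_ops n (\<lambda>i\<in>{1..n}. abs_ribbon_op (w (l i))) l G, l) \<in> ordered_pairs n"
      using pair_act_closed[OF x Gl] unfolding x_def pair_act_def by simp
    have "((apply_ops n (\<lambda>i\<in>{1..n}. abs_ribbon_op (w (l i))) l G, l), (act_words w G, l))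
      \<in> ordered_iso n"
    proof (rule same_arrows_imp_ordered_iso[OF closed mem])
      fix e assume "e \<in> edges (apply_ops n (\<lambda>i\<in>{1..n}. abs_ribbon_op (w (l i))) l G)"
      then have e: "e \<in> l ` {1..n}" using l unfolding bij_betw_def by simp
      then have "inv_into {1..n} l e \<in> {1..n}" "l (inv_into {1..n} l e) = e"
        by (rule inv_into_into, rule f_inv_into_f)
      then show "same_arrows (arrows (apply_ops n (\<lambda>i\<in>{1..n}. abs_ribbon_op (w (l i))) l G) e)
          (arrows (act_words w G) e)"
        by (simp add: op_act_abs del: atLeastAtMost_iff)
    qed simp_all
    then show ?thesis unfolding x_def pair_act_def by simp
  qed
  then have "iso_class n (act_words w G, l) = class_act n x (iso_class n (G, l))"
    using class_act_iso_class[OF x Gl] iso_class_eq by metis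
  then show "iso_class n (act_words w G, l) \<in> orbit (op_group n) (class_act n) (iso_class n (G, l))"
    using x unfolding orbit_def by blast
qed

text \<open>Each of the arrows \<open>ab\<close> and \<open>cd\<close> of \<open>e\<close> lies on a single circle, so \<open>p\<close> and \<open>q\<close> can only be separated if
  \<open>a\<close> and \<open>c\<close> are. The dual arrow \<open>bc\<close> then makes the connection.\<close>

lemma partial_dual_merges_circles:
  assumes G: "ribbon_graph G" and e: "e \<in> edges G"
    and pq: "p \<in> arrow_ends (arrows G e)" "q \<in> arrow_ends (arrows G e)"
    and sep: "(p, q) \<notin> (circle_step (act_words w G))\<^sup>*"
  shows "\<exists>w'. (circle_step (act_words w G))\<^sup>* \<subset> (circle_step (act_words w' G))\<^sup>*"
proof -
  define w' where "w' = w(e := Delta # w e)"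
  let ?H = "act_words w G" and ?H' = "act_words w' G"
  have H: "ribbon_graph ?H" "ribbon_graph ?H'" using G by (simp_all add: ribbon_graph_act_words)
  obtain a b c d where abcd: "arrows ?H e = ((a, b), (c, d))" by (metis surj_pair)
  have e': "e \<in> edges ?H" "e \<in> edges ?H'" using e by simp_all
  have abcd': "arrows ?H' e = ((b, c), (d, a))" using abcd unfolding w'_def by simp
  note partners = partner_arrows[OF H(1) e'(1) abcd] and partners' = partner_arrows[OF H(2) e'(2) abcd']
  have ends: "arrow_ends (arrows G e) = {a, b, c, d}"
    using abcd word_act_ends[of "w e" "arrows G e"] by simp
  then have P: "a \<in> points G" "b \<in> points G" "c \<in> points G" "d \<in> points G"
    using ends_in_points[OF e] by auto
  let ?S = "(circle_step ?H)\<^sup>*"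
  have symS: "(s, r) \<in> ?S" if "(r, s) \<in> ?S" for r s
    using that sym_rtrancl[OF sym_circle_step[OF H(1)]] by (meson symD)
  have ab: "(a, b) \<in> ?S" "(c, d) \<in> ?S"
    using P partners unfolding circle_step_links[OF H(1)] links_def by auto
  have ac: "(a, c) \<notin> ?S"
  proof
    assume ac: "(a, c) \<in> ?S"
    have "(a, r) \<in> ?S" if "r \<in> {a, b, c, d}" for r
      using that ac ab by (auto intro: rtrancl_trans)
    then have "(a, p) \<in> ?S" "(a, q) \<in> ?S" using pq ends by auto
    then show False using sep symS by (meson rtrancl_trans)
  qed
  have "partner ?H' r = partner ?H r" if r: "r \<in> points G" "r \<notin> {a, b, c, d}" for r
  proof -
    obtain e1 where e1: "e1 \<in> edges G" "r \<in> arrow_ends (arrows G e1)"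
      using r(1) unfolding points_def by blast
    then have "e1 \<noteq> e" using r(2) ends by auto
    then have same: "arrows ?H' e1 = arrows ?H e1" unfolding w'_def by simp
    obtain x y z t where xyzt: "arrows ?H e1 = ((x, y), (z, t))" by (metis surj_pair)
    have "r \<in> {x, y, z, t}" using e1(2) xyzt word_act_ends[of "w e1" "arrows G e1"] by simp
    then show ?thesis
      using partner_arrows[OF H(1) _ xyzt] partner_arrows[OF H(2) _ same[unfolded xyzt]] e1(1) by auto
  qed
  moreover have "pairing (points G) (arc G)" "pairing (points G) (partner ?H)"
      "pairing (points G) (partner ?H')"
    using pairing_arc[OF G] pairing_partner[OF H(1)] pairing_partner[OF H(2)] by simp_all
  moreover have "(a, c) \<notin> (links (points G) (arc G) (partner ?H))\<^sup>*"
    using ac circle_step_links[OF H(1)] by simp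
  ultimately have "?S \<subseteq> (circle_step ?H')\<^sup>*" "(a, c) \<in> (circle_step ?H')\<^sup>*"
    using circles_merge[of "points G" "arc G" "partner ?H" "partner ?H'" a c] finite_points[OF G] P
      partners partners' circle_step_links[OF H(1)] circle_step_links[OF H(2)] by simp_all
  then show ?thesis using ac by blast
qed

text \<open>Choose the operations so that the relation of lying on a common circle, restricted to the
  finite set of points, has the greatest possible cardinality. By
  \<open>partial_dual_merges_circles\<close> each edge then meets one circle only.\<close>

lemma all_points_on_one_circle:
  assumes G: "ribbon_graph G" "connected_ribbon_graph G"
  shows "\<exists>w. \<forall>p\<in>points G. (circle_step (act_words w G))\<^sup>* `` {p} = points G"
proof -
  define S where "S w = (circle_step (act_words w G))\<^sup>*" for w
  let ?P = "points G \<times> points G"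
  have fin: "finite ?P" using finite_points[OF G(1)] by simp
  have "\<forall>w. True \<longrightarrow> card (S w \<inter> ?P) < Suc (card ?P)"
    using card_mono[OF fin] by (simp add: less_Suc_eq_le)
  then obtain w where max: "\<And>w'. card (S w' \<inter> ?P) \<le> card (S w \<inter> ?P)"
    using ex_has_greatest_nat[of "\<lambda>_. True" _ "\<lambda>w. card (S w \<inter> ?P)"] by blast
  let ?H = "act_words w G"
  have H: "ribbon_graph ?H" using G(1) by (rule ribbon_graph_act_words)
  have inP: "q \<in> points G" if "(p, q) \<in> S w'" "p \<in> points G" for p q w'
    using that unfolding S_def
    by (induction rule: rtrancl_induct)
      (use circle_step_points[OF ribbon_graph_act_words[OF G(1)]] in auto)
  have inP': "p \<in> points G" if "(p, q) \<in> S w'" "p \<noteq> q" for p q w'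
    using that circle_step_points[OF ribbon_graph_act_words[OF G(1)]] unfolding S_def
    by (metis act_words_simps(5) converse_rtranclE)
  have edge: "(p, q) \<in> S w"
    if e: "e \<in> edges G" "p \<in> arrow_ends (arrows G e)" "q \<in> arrow_ends (arrows G e)" for e p q
  proof (rule ccontr)
    assume "(p, q) \<notin> S w"
    then obtain w' where w': "S w \<subset> S w'"
      using partial_dual_merges_circles[OF G(1) e] unfolding S_def by blast
    then obtain r s where rs: "(r, s) \<in> S w'" "(r, s) \<notin> S w" by auto
    then have "r \<noteq> s" unfolding S_def by auto
    then have "(r, s) \<in> ?P" using inP' inP rs(1) by blast
    then have "S w \<inter> ?P \<subset> S w' \<inter> ?P" using rs w' by blast
    then show False using max[of w'] psubset_card_mono[OF finite_Int] fin by (metis leD)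
  qed
  have "S w `` {p} = points G" if p: "p \<in> points G" for p
  proof
    show "S w `` {p} \<subseteq> points G" using inP p by blast
    have arc: "arc G q \<in> S w `` {p}" if q: "q \<in> S w `` {p}" "q \<in> points G" for q
    proof -
      have "(q, arc G q) \<in> circle_step ?H" using q(2) unfolding circle_step_links[OF H] links_def by simp
      then show ?thesis using q(1) unfolding S_def by (auto intro: rtrancl_into_rtrancl)
    qed
    have "r \<in> S w `` {p}" if "e \<in> edges G" "q \<in> arrow_ends (arrows G e)"
      "r \<in> arrow_ends (arrows G e)" "q \<in> S w `` {p}" for e q r
      using edge[OF that(1-3)] that(4) unfolding S_def by (auto intro: rtrancl_trans)
    moreover have "p \<in> S w `` {p}" unfolding S_def by simp
    ultimately show "points G \<subseteq> S w `` {p}"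
      using connected_closed_set[OF G _ p arc] by blast
  qed
  then show ?thesis unfolding S_def by blast
qed

theorem proposition6p1:
  fixes n :: nat and G :: "('e, 'p) ribbon_graph" and l :: "nat \<Rightarrow> 'e"
  assumes "n \<ge> 1"
    and "(G, l) \<in> ordered_pairs n"
    and "connected_ribbon_graph G"
  shows "\<exists>H m. (H, m) \<in> ordered_pairs n \<and> OEB H \<and>
           iso_class n (H, m) \<in> orbit (op_group n) (class_act n) (iso_class n (G, l))"
proof -
  have G: "ribbon_graph G" and "card (edges G) = n" using assms(2) unfolding ordered_pairs_def by auto
  then obtain e\<^sub>0 where e\<^sub>0: "e\<^sub>0 \<in> edges G" using assms(1) by fastforce
  obtain x y where "arrows G e\<^sub>0 = (x, y)" by (metis surj_pair)
  then obtain p\<^sub>0 where "p\<^sub>0 \<in> arrow_ends (arrows G e\<^sub>0)" by (cases x; cases y) auto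
  then have p\<^sub>0: "p\<^sub>0 \<in> points G" using ends_in_points[OF e\<^sub>0] by blast
  obtain w where w: "\<And>p. p \<in> points G \<Longrightarrow> (circle_step (act_words w G))\<^sup>* `` {p} = points G"
    using all_points_on_one_circle[OF G assms(3)] by blast
  let ?K = "act_words w G"
  have K: "ribbon_graph ?K" using G by (rule ribbon_graph_act_words)
  obtain \<sigma> :: "'p \<Rightarrow> bool" where
    \<sigma>: "\<And>q. q \<in> points G \<Longrightarrow> \<sigma> (arc G q) \<noteq> \<sigma> q \<and> \<sigma> (partner ?K q) \<noteq> \<sigma> q"
    using alternating_colouring[of "points G" "arc G" "partner ?K" p\<^sub>0] finite_points[OF G]
      pairing_arc[OF G] pairing_partner[OF K] p\<^sub>0 w[OF p\<^sub>0] circle_step_links[OF K] by auto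
  define tail\<^sub>1 tail\<^sub>2 :: "'e \<Rightarrow> 'p" where "tail\<^sub>1 e = fst (fst (arrows ?K e))"
    and "tail\<^sub>2 e = fst (snd (arrows ?K e))" for e
  define v where "v e = (if \<sigma> (tail\<^sub>1 e) = \<sigma> (tail\<^sub>2 e) then w e else Tau # w e)" for e
  let ?H = "act_words v G"
  have H: "ribbon_graph ?H" using G by (rule ribbon_graph_act_words)
  have twist: "arrow_set (arrows ?H e) \<union> (arrow_set (arrows ?H e))\<inverse>
      = arrow_set (arrows ?K e) \<union> (arrow_set (arrows ?K e))\<inverse>" for e
  proof -
    obtain a b c d where abcd: "arrows ?K e = ((a, b), (c, d))" by (metis surj_pair)
    then show ?thesis unfolding v_def by auto
  qed
  have steps: "circle_step ?H = circle_step ?K"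
  proof -
    have "circle_step J = {(p, arc J p) | p. p \<in> points J} \<union>
        (\<Union>e\<in>edges J. arrow_set (arrows J e) \<union> (arrow_set (arrows J e))\<inverse>)"
      for J :: "('e, 'p) ribbon_graph"
      unfolding circle_step_def Let_def by auto
    then show ?thesis by (simp only: twist act_words_simps(1,2,5))
  qed
  have "vertex_at ?H p = Inl (points G)" if "p \<in> points G" for p
    using w[OF that] unfolding vertex_at_def steps by simp
  then have "vertex_at ?H ` points G = {Inl (points G)}" using p\<^sub>0 by force
  then have "vertices ?H = {Inl (points G)}"
    using no_empty_circles[OF assms(3) p\<^sub>0] unfolding vertices_def by simp
  moreover have "orientable ?H"
    unfolding orientable_def
  proof (intro exI conjI ballI)
    show "\<sigma> (arc ?H p) \<noteq> \<sigma> p" if "p \<in> points ?H" for p using \<sigma> that by simp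
    fix e u assume e: "e \<in> edges ?H" and u: "u \<in> arrow_set (arrows ?H e)"
    obtain a b c d where abcd: "arrows ?K e = ((a, b), (c, d))" by (metis surj_pair)
    have e': "e \<in> edges ?K" using e by simp
    have "{a, b, c, d} \<subseteq> points G" using ends_in_points[OF e'] abcd by simp
    then have "\<sigma> b \<noteq> \<sigma> a" "\<sigma> d \<noteq> \<sigma> c"
      using \<sigma>[of a] \<sigma>[of c] partner_arrows[OF K e' abcd] by auto
    moreover have "arrows ?H e = (if \<sigma> a = \<sigma> c then ((a, b), (c, d)) else ((a, b), (d, c)))"
      using abcd unfolding v_def tail\<^sub>1_def tail\<^sub>2_def by simp
    \<comment> \<open>A twist keeps the first arrow, so its tail in \<open>?K\<close> also determines the orientation of \<open>e\<close>.\<close>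
    ultimately show "case u of (t, h) \<Rightarrow> \<sigma> t \<noteq> \<sigma> h \<and> \<sigma> t \<noteq> (\<not> \<sigma> (tail\<^sub>1 e))"
      using u abcd unfolding tail\<^sub>1_def by (auto split: if_splits)
  qed
  ultimately have "OEB ?H" using H unfolding OEB_def by simp
  then show ?thesis using act_words_in_orbit[OF assms(2)] by blast
qed

end
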